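(* Let $R_1,R_2$ be rings with identities, let $S_i\subseteq R_i$ be an $m$-system of $R_i$ for $i=1,2$, and let $P$ be an ideal of $R_1$. Let $R=R_1\times R_2$ and $S=S_1\times S_2$. Then the following statements are equivalent. (1) $P$ is an almost right $S_1$-prime ideal of $R_1$. (2) $P\times R_2$ is an almost right $S$-prime ideal of $R_1\times R_2$.
   Context: Rings are associative and not necessarily commutative; ideals are two-sided. An $m$-system of a ring $R$ is a nonempty subset $S\subseteq R$ such that for all $a,b\in S$ there is $r\in R$ with $arb\in S$; $S_1\times S_2$ is then an $m$-system of $R_1\times R_2$. $\langle s\rangle$ denotes the two-sided ideal generated by $s$. For ideals $A,B$, $AB$ is the additive subgroup generated by products $ab$ ($a\in A,b\in B$), and $P^2=PP$. An ideal $P$ of $R$ with $P\cap S=\emptyset$ is an almost right $S$-prime ideal if there is an element $s\in S$ such that for all ideals $A,B$ of $R$ with $AB\subseteq P$ and $AB\not\subseteq P^2$, either $A\langle s\rangle\subseteq P$ or $B\langle s\rangle\subseteq P$. *)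

theory Defs
  imports "HOL-Algebra.Ideal_Product" "HOL-Algebra.Chinese_Remainder"
begin

definition m_system :: "'a set \<Rightarrow> ('a, 'm) ring_scheme \<Rightarrow> bool" where
  "m_system S R \<longleftrightarrow>
     S \<noteq> {} \<and> S \<subseteq> carrier R \<and>
     (\<forall>a\<in>S. \<forall>b\<in>S. \<exists>r\<in>carrier R. a \<otimes>\<^bsub>R\<^esub> r \<otimes>\<^bsub>R\<^esub> b \<in> S)"

(* ideal_prod R A B is the closure of the products a b (a in A, b in B) under addition.  As A and B
   are ideals, this set already contains zero and additive inverses (ring.ideal_prod_is_ideal), so
   it is the additive subgroup generated by these products. *)
definition almost_right_S_prime :: "'a set \<Rightarrow> 'a set \<Rightarrow> ('a, 'm) ring_scheme \<Rightarrow> bool" where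
  "almost_right_S_prime S P R \<longleftrightarrow>
     ideal P R \<and> P \<inter> S = {} \<and>
     (\<exists>s\<in>S. \<forall>A B. ideal A R \<longrightarrow> ideal B R \<longrightarrow>
        ideal_prod R A B \<subseteq> P \<longrightarrow> \<not> ideal_prod R A B \<subseteq> ideal_prod R P P \<longrightarrow>
        ideal_prod R A (Idl\<^bsub>R\<^esub> {s}) \<subseteq> P \<or> ideal_prod R B (Idl\<^bsub>R\<^esub> {s}) \<subseteq> P)"

end

theory Submission
  imports Defs
begin

text \<open>
  The idempotents \<open>(1, 0)\<close> and \<open>(0, 1)\<close> split every ideal of \<open>R \<times> S\<close> into a box \<open>I \<times> J\<close> of
  ideals of the factors (\<open>ideal_RDirProd_box\<close>). Both operations in the definition of an almost
  right \<open>S\<close>-prime ideal respect boxes: products of ideals (\<open>ideal_prod_Times\<close>) and the ideal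
  generated by one element (\<open>genideal_RDirProd\<close>). In particular
  \<open>(P \<times> R2)\<^sup>2 = P\<^sup>2 \<times> R2\<close>, because \<open>R2\<close> has an identity.

  Every containment in the definition for \<open>P \<times> R2\<close> therefore compares a box with a box whose
  second side is all of \<open>R2\<close>, and says exactly the same as the containment of the first sides
  (\<open>ideal_prod_Times_subset_iff\<close>). Hence \<open>(s, t)\<close> is a witness for \<open>P \<times> R2\<close> if and only
  if \<open>s\<close> is a witness for \<open>P\<close>, whatever \<open>t\<close> is; since \<open>S2\<close> is nonempty, a witness \<open>s\<close> can
  always be completed to a pair, and disjointness from \<open>S1 \<times> S2\<close> is disjointness from \<open>S1\<close>.
\<close>

lemma RDirProd_mult [simp]:
  "(a, b) \<otimes>\<^bsub>RDirProd R S\<^esub> (c, d) = (a \<otimes>\<^bsub>R\<^esub> c, b \<otimes>\<^bsub>S\<^esub> d)"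
  by (simp add: RDirProd_def monoid.defs)

lemma RDirProd_plus [simp]:
  "(a, b) \<oplus>\<^bsub>RDirProd R S\<^esub> (c, d) = (a \<oplus>\<^bsub>R\<^esub> c, b \<oplus>\<^bsub>S\<^esub> d)"
  by (simp add: RDirProd_def monoid.defs)

text \<open>Since the ring has an identity, closure under negation is closure under multiplication
  by \<open>-1\<close>.\<close>

lemma (in ring) ideal_if_closed:
  assumes "I \<subseteq> carrier R" "I \<noteq> {}"
    and add: "\<And>x y. x \<in> I \<Longrightarrow> y \<in> I \<Longrightarrow> x \<oplus> y \<in> I"
    and left: "\<And>r x. r \<in> carrier R \<Longrightarrow> x \<in> I \<Longrightarrow> r \<otimes> x \<in> I"
    and right: "\<And>r x. r \<in> carrier R \<Longrightarrow> x \<in> I \<Longrightarrow> x \<otimes> r \<in> I"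
  shows "ideal I R"
proof (rule idealI[OF ring_axioms])
  have "\<ominus> x \<in> I" if "x \<in> I" for x
  proof -
    have "\<ominus> x = (\<ominus> \<one>) \<otimes> x" using that assms(1) by (simp add: l_minus subset_iff)
    then show ?thesis using left[of "\<ominus> \<one>" x] that by simp
  qed
  then show "subgroup I (add_monoid R)"
    using assms(1,2) add by (intro add.subgroupI) (auto simp: a_inv_def)
qed (use left right in auto)

lemma ideal_Times:
  assumes "ideal I R" "ideal J S"
  shows "ideal (I \<times> J) (RDirProd R S)"
proof -
  interpret I: ideal I R by fact
  interpret J: ideal J S by fact
  interpret RS: ring "RDirProd R S" by (rule RDirProd_ring) (rule I.ring_axioms J.ring_axioms)+
  have "(\<zero>\<^bsub>R\<^esub>, \<zero>\<^bsub>S\<^esub>) \<in> I \<times> J" by simp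
  then have "I \<times> J \<noteq> {}" by blast
  then show ?thesis
    by (intro RS.ideal_if_closed)
      (auto simp: RDirProd_carrier I.I_l_closed I.I_r_closed J.I_l_closed J.I_r_closed)
qed

text \<open>For \<open>(a, b)\<close> and \<open>(a', b')\<close> in an ideal \<open>K\<close>, the mixed pair \<open>(a, b')\<close> is
  \<open>(1, 0) (a, b) + (0, 1) (a', b')\<close>, so \<open>K\<close> is the product of its two projections.\<close>

lemma ideal_RDirProd_box:
  assumes "ring R" "ring S" "ideal K (RDirProd R S)"
  obtains I J where "ideal I R" "ideal J S" "K = I \<times> J"
proof -
  interpret R: ring R by fact
  interpret S: ring S by fact
  interpret K: ideal K "RDirProd R S" by fact
  have carr: "a \<in> carrier R" "b \<in> carrier S" if "(a, b) \<in> K" for a b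
    using K.Icarr[OF that] by (auto simp: RDirProd_carrier)
  have add: "(a \<oplus>\<^bsub>R\<^esub> c, b \<oplus>\<^bsub>S\<^esub> d) \<in> K" if "(a, b) \<in> K" "(c, d) \<in> K" for a b c d
    using additive_subgroup.a_closed[OF K.is_additive_subgroup that] by simp
  have left: "(r \<otimes>\<^bsub>R\<^esub> a, s \<otimes>\<^bsub>S\<^esub> b) \<in> K"
    and right: "(a \<otimes>\<^bsub>R\<^esub> r, b \<otimes>\<^bsub>S\<^esub> s) \<in> K"
    if "(a, b) \<in> K" "r \<in> carrier R" "s \<in> carrier S" for a b r s
    using K.I_l_closed[OF that(1), of "(r, s)"] K.I_r_closed[OF that(1), of "(r, s)"] that
    by (auto simp: RDirProd_carrier)
  have ne: "K \<noteq> {}" using additive_subgroup.zero_closed[OF K.is_additive_subgroup] by blast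
  have mix: "(a, b') \<in> K" if "(a, b) \<in> K" "(a', b') \<in> K" for a b a' b'
    using add[OF left[OF that(1), of "\<one>\<^bsub>R\<^esub>" "\<zero>\<^bsub>S\<^esub>"] left[OF that(2), of "\<zero>\<^bsub>R\<^esub>" "\<one>\<^bsub>S\<^esub>"]]
      carr[OF that(1)] carr[OF that(2)] by simp
  have "ideal (fst ` K) R"
  proof (rule R.ideal_if_closed)
    fix x y assume "x \<in> fst ` K" "y \<in> fst ` K"
    then obtain b d where "(x, b) \<in> K" "(y, d) \<in> K" by auto
    from add[OF this] show "x \<oplus>\<^bsub>R\<^esub> y \<in> fst ` K" by (rule image_eqI[rotated]) simp
  next
    fix r x assume r: "r \<in> carrier R" and "x \<in> fst ` K"
    then obtain b where K: "(x, b) \<in> K" by auto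
    from left[OF K r S.one_closed] show "r \<otimes>\<^bsub>R\<^esub> x \<in> fst ` K" by (rule image_eqI[rotated]) simp
    from right[OF K r S.one_closed] show "x \<otimes>\<^bsub>R\<^esub> r \<in> fst ` K" by (rule image_eqI[rotated]) simp
  qed (use carr ne in auto)
  moreover have "ideal (snd ` K) S"
  proof (rule S.ideal_if_closed)
    fix x y assume "x \<in> snd ` K" "y \<in> snd ` K"
    then obtain b d where "(b, x) \<in> K" "(d, y) \<in> K" by auto
    from add[OF this] show "x \<oplus>\<^bsub>S\<^esub> y \<in> snd ` K" by (rule image_eqI[rotated]) simp
  next
    fix r x assume r: "r \<in> carrier S" and "x \<in> snd ` K"
    then obtain b where K: "(b, x) \<in> K" by auto
    from left[OF K R.one_closed r] show "r \<otimes>\<^bsub>S\<^esub> x \<in> snd ` K" by (rule image_eqI[rotated]) simp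
    from right[OF K R.one_closed r] show "x \<otimes>\<^bsub>S\<^esub> r \<in> snd ` K" by (rule image_eqI[rotated]) simp
  qed (use carr ne in auto)
  moreover have "K = fst ` K \<times> snd ` K"
  proof
    show "fst ` K \<times> snd ` K \<subseteq> K" by clarify (simp only: fst_conv snd_conv, rule mix)
    show "K \<subseteq> fst ` K \<times> snd ` K" by (rule subset_fst_snd)
  qed
  ultimately show thesis by (rule that)
qed

lemma ideal_prod_zero_mem:
  assumes "ideal I R" "ideal J R"
  shows "\<zero>\<^bsub>R\<^esub> \<in> ideal_prod R I J"
proof -
  interpret I: ideal I R by fact
  interpret IJ: ideal "ideal_prod R I J" R
    using assms by (rule I.ideal_prod_is_ideal)
  show ?thesis by (rule additive_subgroup.zero_closed[OF IJ.is_additive_subgroup])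
qed

text \<open>A pair of sums of products need not have matching lengths; padding each coordinate
  with zeros, \<open>(x, y) = (x, 0) + (0, y)\<close>, reduces to one coordinate at a time.\<close>

lemma ideal_prod_Times:
  assumes "ideal A R" "ideal B R" "ideal C S" "ideal D S"
  shows "ideal_prod (RDirProd R S) (A \<times> C) (B \<times> D) = ideal_prod R A B \<times> ideal_prod S C D"
    (is "?L = ?AB \<times> ?CD")
proof
  interpret A: ideal A R by fact
  interpret B: ideal B R by fact
  interpret C: ideal C S by fact
  interpret D: ideal D S by fact
  show "?L \<subseteq> ?AB \<times> ?CD"
  proof
    fix z assume "z \<in> ?L"
    then show "z \<in> ?AB \<times> ?CD"
      by induction (auto intro: ideal_prod.intros)
  qed
  have left: "(x, \<zero>\<^bsub>S\<^esub>) \<in> ?L" if "x \<in> ?AB" for x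
    using that
  proof induction
    case (prod i j)
    then have "(i, \<zero>\<^bsub>S\<^esub>) \<otimes>\<^bsub>RDirProd R S\<^esub> (j, \<zero>\<^bsub>S\<^esub>) \<in> ?L"
      by (intro ideal_prod.prod) auto
    then show ?case by simp
  next
    case (sum x y)
    from ideal_prod.sum[OF sum.IH] show ?case by simp
  qed
  have right: "(\<zero>\<^bsub>R\<^esub>, y) \<in> ?L" if "y \<in> ?CD" for y
    using that
  proof induction
    case (prod i j)
    then have "(\<zero>\<^bsub>R\<^esub>, i) \<otimes>\<^bsub>RDirProd R S\<^esub> (\<zero>\<^bsub>R\<^esub>, j) \<in> ?L"
      by (intro ideal_prod.prod) auto
    then show ?case by simp
  next
    case (sum x y)
    from ideal_prod.sum[OF sum.IH] show ?case by simp
  qed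
  show "?AB \<times> ?CD \<subseteq> ?L"
  proof clarify
    fix x y assume xy: "x \<in> ?AB" "y \<in> ?CD"
    then have "x \<in> carrier R" "y \<in> carrier S"
      using A.ideal_prod_in_carrier[OF assms(1,2)] C.ideal_prod_in_carrier[OF assms(3,4)] by auto
    with ideal_prod.sum[OF left[OF xy(1)] right[OF xy(2)]] show "(x, y) \<in> ?L" by simp
  qed
qed

lemma genideal_RDirProd:
  assumes "ring R" "ring S" "a \<in> carrier R" "b \<in> carrier S"
  shows "Idl\<^bsub>RDirProd R S\<^esub> {(a, b)} = (Idl\<^bsub>R\<^esub> {a}) \<times> (Idl\<^bsub>S\<^esub> {b})"
proof
  interpret R: ring R by fact
  interpret S: ring S by fact
  interpret RS: ring "RDirProd R S" by (rule RDirProd_ring) fact+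
  show "Idl\<^bsub>RDirProd R S\<^esub> {(a, b)} \<subseteq> (Idl\<^bsub>R\<^esub> {a}) \<times> (Idl\<^bsub>S\<^esub> {b})"
    using assms
    by (intro RS.genideal_minimal ideal_Times R.genideal_ideal S.genideal_ideal)
      (auto intro: R.genideal_self' S.genideal_self')
  have ab: "(a, b) \<in> carrier (RDirProd R S)" using assms by (simp add: RDirProd_carrier)
  then have "ideal (Idl\<^bsub>RDirProd R S\<^esub> {(a, b)}) (RDirProd R S)"
    by (intro RS.genideal_ideal) simp
  then obtain I J where IJ: "ideal I R" "ideal J S" "Idl\<^bsub>RDirProd R S\<^esub> {(a, b)} = I \<times> J"
    by (rule ideal_RDirProd_box[OF assms(1,2)])
  have "a \<in> I" "b \<in> J"
    using RS.genideal_self'[OF ab] IJ(3) by auto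
  with IJ show "(Idl\<^bsub>R\<^esub> {a}) \<times> (Idl\<^bsub>S\<^esub> {b}) \<subseteq> Idl\<^bsub>RDirProd R S\<^esub> {(a, b)}"
    using R.genideal_minimal[of I "{a}"] S.genideal_minimal[of J "{b}"] by auto
qed

lemma ideal_prod_carrier_carrier:
  assumes "ring R"
  shows "ideal_prod R (carrier R) (carrier R) = carrier R"
proof -
  interpret R: ring R by fact
  show ?thesis
    using R.ideal_prod_in_carrier[OF R.oneideal R.oneideal]
      ideal_prod.prod[of _ "carrier R" "\<one>\<^bsub>R\<^esub>" "carrier R" R] by force
qed

text \<open>The second side of the product of two boxes is a nonempty subset of \<open>S\<close>: a subset, so it
  imposes nothing in a containment in \<open>Q \<times> S\<close>; nonempty, so the first side can be read off.\<close>

lemma ideal_prod_Times_subset_iff: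
  assumes "ideal A R" "ideal B R" "ideal C S" "ideal D S"
  shows "ideal_prod (RDirProd R S) (A \<times> C) (B \<times> D) \<subseteq> Q \<times> carrier S \<longleftrightarrow> ideal_prod R A B \<subseteq> Q"
proof -
  interpret C: ideal C S by fact
  show ?thesis
    unfolding ideal_prod_Times[OF assms]
    using C.ideal_prod_in_carrier[OF assms(3,4)] ideal_prod_zero_mem[OF assms(3,4)] by auto
qed

theorem theorem3p20:
  fixes R1 :: "('a, 'm) ring_scheme" and R2 :: "('b, 'n) ring_scheme"
    and S1 P :: "'a set" and S2 :: "'b set"
  assumes "ring R1" and "ring R2"
    and "m_system S1 R1" and "m_system S2 R2"
    and "ideal P R1"
  shows "almost_right_S_prime S1 P R1 \<longleftrightarrow>
         almost_right_S_prime (S1 \<times> S2) (P \<times> carrier R2) (RDirProd R1 R2)"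
proof -
  interpret R1: ring R1 by fact
  interpret R2: ring R2 by fact
  let ?R = "RDirProd R1 R2" and ?Q = "P \<times> carrier R2"
  define almost where "almost A B s \<longleftrightarrow>
      (ideal_prod R1 A B \<subseteq> P \<longrightarrow> \<not> ideal_prod R1 A B \<subseteq> ideal_prod R1 P P \<longrightarrow>
        ideal_prod R1 A (Idl\<^bsub>R1\<^esub> {s}) \<subseteq> P \<or> ideal_prod R1 B (Idl\<^bsub>R1\<^esub> {s}) \<subseteq> P)" for A B s
  have S: "S1 \<subseteq> carrier R1" "S2 \<subseteq> carrier R2" "S2 \<noteq> {}"
    using assms(3,4) by (auto simp: m_system_def)
  have Q: "ideal ?Q ?R"
    by (rule ideal_Times[OF assms(5) R2.oneideal])
  have QQ: "ideal_prod ?R ?Q ?Q = ideal_prod R1 P P \<times> carrier R2"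
    by (simp add: ideal_prod_Times assms R2.oneideal ideal_prod_carrier_carrier)
  have box: "(ideal_prod ?R (A \<times> C) (B \<times> D) \<subseteq> ?Q \<longrightarrow>
        \<not> ideal_prod ?R (A \<times> C) (B \<times> D) \<subseteq> ideal_prod ?R ?Q ?Q \<longrightarrow>
        ideal_prod ?R (A \<times> C) (Idl\<^bsub>?R\<^esub> {(s, t)}) \<subseteq> ?Q \<or>
        ideal_prod ?R (B \<times> D) (Idl\<^bsub>?R\<^esub> {(s, t)}) \<subseteq> ?Q) \<longleftrightarrow> almost A B s"
    if "ideal A R1" "ideal B R1" "ideal C R2" "ideal D R2" "s \<in> S1" "t \<in> S2" for A B C D s t
  proof -
    have st: "s \<in> carrier R1" "t \<in> carrier R2" using that S by auto
    then have "ideal (Idl\<^bsub>R1\<^esub> {s}) R1" "ideal (Idl\<^bsub>R2\<^esub> {t}) R2"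
      by (auto intro: R1.genideal_ideal R2.genideal_ideal)
    with that show ?thesis
      unfolding QQ genideal_RDirProd[OF assms(1,2) st] almost_def
      by (simp add: ideal_prod_Times_subset_iff)
  qed
  have witness: "(\<forall>A B. ideal A ?R \<longrightarrow> ideal B ?R \<longrightarrow>
        ideal_prod ?R A B \<subseteq> ?Q \<longrightarrow> \<not> ideal_prod ?R A B \<subseteq> ideal_prod ?R ?Q ?Q \<longrightarrow>
        ideal_prod ?R A (Idl\<^bsub>?R\<^esub> {(s, t)}) \<subseteq> ?Q \<or> ideal_prod ?R B (Idl\<^bsub>?R\<^esub> {(s, t)}) \<subseteq> ?Q) \<longleftrightarrow>
      (\<forall>A B. ideal A R1 \<longrightarrow> ideal B R1 \<longrightarrow> almost A B s)" (is "?prod \<longleftrightarrow> ?fst")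
    if st: "s \<in> S1" "t \<in> S2" for s t
  proof
    assume p: ?prod
    show ?fst
    proof (intro allI impI)
      fix A B
      assume AB: "ideal A R1" "ideal B R1"
      \<comment> \<open>Test \<open>A\<close> and \<open>B\<close> in the product as the boxes \<open>A \<times> R2\<close> and \<open>B \<times> R2\<close>.\<close>
      show "almost A B s"
        using p[rule_format, OF ideal_Times[OF AB(1) R2.oneideal] ideal_Times[OF AB(2) R2.oneideal]]
        unfolding box[OF AB R2.oneideal R2.oneideal st, symmetric] by blast
    qed
  next
    assume f: ?fst
    show ?prod
    proof (intro allI impI)
      fix A B
      assume ideals: "ideal A ?R" "ideal B ?R"
        and sub: "ideal_prod ?R A B \<subseteq> ?Q" "\<not> ideal_prod ?R A B \<subseteq> ideal_prod ?R ?Q ?Q"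
      obtain A1 A2 where A: "ideal A1 R1" "ideal A2 R2" "A = A1 \<times> A2"
        using ideals(1) by (rule ideal_RDirProd_box[OF assms(1,2)])
      obtain B1 B2 where B: "ideal B1 R1" "ideal B2 R2" "B = B1 \<times> B2"
        using ideals(2) by (rule ideal_RDirProd_box[OF assms(1,2)])
      show "ideal_prod ?R A (Idl\<^bsub>?R\<^esub> {(s, t)}) \<subseteq> ?Q \<or> ideal_prod ?R B (Idl\<^bsub>?R\<^esub> {(s, t)}) \<subseteq> ?Q"
        using box[OF A(1) B(1) A(2) B(2) st] f A B sub by blast
    qed
  qed
  have "?Q \<inter> (S1 \<times> S2) = {} \<longleftrightarrow> P \<inter> S1 = {}"
    using S by auto
  moreover have "(\<exists>st\<in>S1 \<times> S2. \<forall>A B. ideal A ?R \<longrightarrow> ideal B ?R \<longrightarrow>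
        ideal_prod ?R A B \<subseteq> ?Q \<longrightarrow> \<not> ideal_prod ?R A B \<subseteq> ideal_prod ?R ?Q ?Q \<longrightarrow>
        ideal_prod ?R A (Idl\<^bsub>?R\<^esub> {st}) \<subseteq> ?Q \<or> ideal_prod ?R B (Idl\<^bsub>?R\<^esub> {st}) \<subseteq> ?Q) \<longleftrightarrow>
      (\<exists>s\<in>S1. \<forall>A B. ideal A R1 \<longrightarrow> ideal B R1 \<longrightarrow> almost A B s)"
    using witness S(3) by (simp add: Bex_def split_paired_Ex) blast
  ultimately show ?thesis
    using Q assms(5) unfolding almost_right_S_prime_def almost_def by simp
qed

end
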